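(* Let $1\leq t<N$ be integers. Every real polynomial $s$ of degree $d\leq N-t$ such that $s(0)=0$ and $1-\varepsilon\leq s(x)\leq 1$ for all integers $x\in[t,N]$ satisfies $$\varepsilon\geq\frac{1}{a}e^{-bd^2/(N-t)-4d\sqrt{tN/(N-t)^2}},$$ where $a,b>0$ are the universal constants of the Coppersmith–Rivlin inequality.
   Context: Coppersmith–Rivlin inequality: there exist universal constants $a,b>0$ such that for every $n$ and every real polynomial $p$ of degree $d$ with $|p(x)|\le 1$ for all integers $x\in[0,n]$, one has $|p(x)|<ae^{bd^2/n}$ for all real $x\in[0,n]$. The constants $a,b$ in the claim are any such constants. *)

theory Defs
  imports Complex_Main "HOL-Computational_Algebra.Polynomial"
begin

text \<open>
  The pair \<open>(a, b)\<close> is admissible in the Coppersmith--Rivlin inequality.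
  The restriction \<open>degree p \<le> n\<close> is the standing one for that inequality: without it no pair would
  be admissible, since large multiples of \<open>x (x - 1) \<dots> (x - n)\<close> vanish at all the sample points.
\<close>

definition coppersmith_rivlin :: "real \<Rightarrow> real \<Rightarrow> bool" where
  "coppersmith_rivlin a b \<longleftrightarrow>
     a > 0 \<and> b > 0 \<and>
     (\<forall>(n::nat) (d::nat) (p::real poly).
        1 \<le> n \<and> degree p = d \<and> d \<le> n \<and> (\<forall>k\<in>{0..n}. \<bar>poly p (real k)\<bar> \<le> 1) \<longrightarrow>
        (\<forall>x\<in>{0..real n}. \<bar>poly p x\<bar> < a * exp (b * (real d)\<^sup>2 / real n)))"

end

(* The error 1 - s, shifted and divided by \<epsilon>, is bounded at the integers of [0, N - t], hence by
   Coppersmith--Rivlin on the whole interval, and it equals 1/\<epsilon> at -t.  How fast it can grow from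
   the interval to -t is controlled by the Chebyshev extremal bound, which follows from the maximum
   modulus principle after the Joukowski substitution x = (w + 1/w)/2. *)
theory Submission
  imports Defs "HOL-Complex_Analysis.Complex_Analysis"
begin

text \<open>The Joukowski map sends the unit circle into [-1, 1], where \<open>M\<close> bounds
  \<open>p\<close>, and some point \<open>u\<close> of the closed unit disc to \<open>x\<close>.
  Multiplying by \<open>w ^ d\<close> clears the pole at 0, and at \<open>u\<close> this costs
  exactly the factor on the right.\<close>

lemma poly_growth_outside_interval:
  fixes p :: "real poly" and M x :: real
  assumes deg: "degree p \<le> d"
    and bound: "\<And>y. \<bar>y\<bar> \<le> 1 \<Longrightarrow> \<bar>poly p y\<bar> \<le> M"
    and x: "1 \<le> x"
  shows "\<bar>poly p x\<bar> \<le> M * (x + sqrt (x\<^sup>2 - 1)) ^ d"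
proof -
  define P :: "complex poly" where "P = map_poly of_real p"
  have P_of_real: "poly P (of_real y) = of_real (poly p y)" for y
    unfolding P_def by (simp add: poly_altdef degree_map_poly coeff_map_poly)
  have degP: "degree P \<le> d"
    using deg unfolding P_def by (simp add: degree_map_poly)
  \<comment> \<open>\<open>w ^ d * P ((w + 1/w) / 2)\<close>, without the removable singularity at 0\<close>
  define q where "q w = (\<Sum>i\<le>d. coeff P i * (w ^ (d - i) * ((w\<^sup>2 + 1) / 2) ^ i))" for w :: complex
  have q_eq: "q w = w ^ d * poly P ((w + 1 / w) / 2)" if "w \<noteq> 0" for w
  proof -
    have "w ^ (d - i) * ((w\<^sup>2 + 1) / 2) ^ i = w ^ d * ((w + 1 / w) / 2) ^ i" if "i \<le> d" for i
    proof -
      have "(w\<^sup>2 + 1) / 2 = w * ((w + 1 / w) / 2)"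
        using \<open>w \<noteq> 0\<close> by (simp add: field_simps power2_eq_square)
      then have "w ^ (d - i) * ((w\<^sup>2 + 1) / 2) ^ i = w ^ (d - i) * w ^ i * ((w + 1 / w) / 2) ^ i"
        by (simp only: power_mult_distrib mult.assoc)
      also have "w ^ (d - i) * w ^ i = w ^ d"
        using that by (simp flip: power_add)
      finally show ?thesis .
    qed
    then have "q w = w ^ d * (\<Sum>i\<le>d. coeff P i * ((w + 1 / w) / 2) ^ i)"
      unfolding q_def sum_distrib_left by (intro sum.cong) (auto simp: mult_ac)
    also have "(\<Sum>i\<le>d. coeff P i * ((w + 1 / w) / 2) ^ i) = poly P ((w + 1 / w) / 2)"
      unfolding poly_altdef using degP
      by (intro sum.mono_neutral_right) (auto simp: coeff_eq_0)
    finally show ?thesis .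
  qed
  have q_circle: "norm (q w) \<le> M" if "norm w = 1" for w
  proof -
    have "w \<noteq> 0" using that by auto
    \<comment> \<open>On the unit circle inversion is conjugation, so the Joukowski map reduces to
      the real part.\<close>
    have "1 / w = cnj w"
      using that by (simp add: complex_div_cnj[of 1 w])
    then have "(w + 1 / w) / 2 = of_real (Re w)"
      by (simp add: complex_add_cnj)
    then show ?thesis
      using that bound[of "Re w"] abs_Re_le_cmod[of w]
      by (simp add: q_eq[OF \<open>w \<noteq> 0\<close>] P_of_real norm_mult norm_power)
  qed
  \<comment> \<open>\<open>u\<close> and \<open>v\<close> are the two Joukowski preimages of
    \<open>x\<close>, inverse to each other; \<open>u\<close> is the one inside the closed
    disc.\<close>
  define u where "u = x - sqrt (x\<^sup>2 - 1)"
  define v where "v = x + sqrt (x\<^sup>2 - 1)"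
  have "x\<^sup>2 \<ge> 1" using x by simp
  then have uv: "u * v = 1"
    unfolding u_def v_def by (simp add: algebra_simps power2_eq_square flip: real_sqrt_mult)
  have v1: "v \<ge> 1"
    using x \<open>x\<^sup>2 \<ge> 1\<close> by (simp add: v_def add_increasing2)
  then have u_eq: "u = 1 / v"
    using uv by (simp add: field_simps)
  have u: "0 < u" "u \<le> 1"
    using v1 by (simp_all add: u_eq)
  have "norm (q (of_real u)) \<le> M"
  proof (rule maximum_modulus_frontier[of q "cball 0 1"])
    show "q holomorphic_on interior (cball 0 1)" "continuous_on (closure (cball 0 1)) q"
      unfolding q_def by (auto intro!: holomorphic_intros continuous_intros)
    show "norm (q z) \<le> M" if "z \<in> frontier (cball 0 1)" for z
      using that by (intro q_circle) simp
    show "of_real u \<in> cball (0::complex) 1"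
      using u by simp
  qed simp
  moreover have "q (of_real u) = of_real (u ^ d * poly p x)"
  proof -
    have "1 / u = v"
      by (simp add: u_eq)
    then have "(u + 1 / u) / 2 = x"
      by (simp add: u_def v_def)
    then have "(of_real u + 1 / of_real u) / 2 = (of_real x :: complex)"
      by (metis of_real_1 of_real_add of_real_divide of_real_numeral)
    then show ?thesis
      using u(1) by (simp add: q_eq P_of_real)
  qed
  ultimately have "u ^ d * \<bar>poly p x\<bar> \<le> M"
    using u(1) by (simp add: abs_mult norm_mult norm_power)
  then have "\<bar>poly p x\<bar> \<le> M * v ^ d"
    using v1 by (simp add: u_eq power_one_over field_simps)
  then show ?thesis
    by (simp add: v_def)
qed

text \<open>With \<open>x = 1 + \<mu>\<close> the root becomes
  \<open>S = sqrt (2 * \<mu> + \<mu>\<^sup>2)\<close>, which dominates \<open>\<mu>\<close>, so the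
  base of the power is at most \<open>1 + 2 * S\<close>, hence at most
  \<open>exp (2 * S)\<close>.\<close>

lemma poly_growth_outside_interval_exp:
  fixes p :: "real poly" and M \<mu> :: real
  assumes "degree p \<le> d"
    and bound: "\<And>y. \<bar>y\<bar> \<le> 1 \<Longrightarrow> \<bar>poly p y\<bar> \<le> M"
    and \<mu>: "0 \<le> \<mu>"
  shows "\<bar>poly p (1 + \<mu>)\<bar> \<le> M * exp (2 * real d * sqrt (2 * \<mu> + \<mu>\<^sup>2))"
proof -
  define S where "S = sqrt (2 * \<mu> + \<mu>\<^sup>2)"
  have S: "\<mu> \<le> S" "0 \<le> S"
    using \<mu> by (auto simp: S_def intro!: real_le_rsqrt)
  have "M \<ge> 0" using bound[of 0] by simp
  have "\<bar>poly p (1 + \<mu>)\<bar> \<le> M * (1 + \<mu> + S) ^ d"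
    using poly_growth_outside_interval[OF assms(1) bound, of "1 + \<mu>"] \<mu>
    by (simp add: S_def power2_sum add_ac)
  also have "1 + \<mu> + S \<le> exp (2 * S)"
    using S exp_ge_add_one_self[of "2 * S"] by linarith
  then have "M * (1 + \<mu> + S) ^ d \<le> M * exp (2 * S) ^ d"
    using \<mu> S \<open>M \<ge> 0\<close> by (intro mult_left_mono power_mono) auto
  also have "exp (2 * S) ^ d = exp (2 * real d * S)"
    by (simp add: exp_of_nat_mult[symmetric] mult_ac)
  finally show ?thesis by (simp add: S_def)
qed

theorem theorem20:
  fixes a b \<epsilon> :: real and t N d :: nat and s :: "real poly"
  assumes "coppersmith_rivlin a b"
    and "1 \<le> t" and "t < N"
    and "degree s = d" and "d \<le> N - t"
    and "poly s 0 = 0"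
    and "\<forall>x\<in>{t..N}. 1 - \<epsilon> \<le> poly s (real x) \<and> poly s (real x) \<le> 1"
  shows "\<epsilon> \<ge> 1 / a * exp (- b * (real d)\<^sup>2 / (real N - real t)
                        - 4 * real d * sqrt (real t * real N / (real N - real t)\<^sup>2))"
    (is "_ \<ge> ?B")
proof -
  define n where "n = N - t"
  have n: "real N - real t = real n" "n \<ge> 1" "real N = real n + real t"
    using assms(3) by (auto simp: n_def)
  have ab: "a > 0" "b > 0"
    using assms(1) by (auto simp: coppersmith_rivlin_def)
  \<comment> \<open>Stated for every positive \<open>\<delta> \<ge> \<epsilon>\<close>, because \<open>\<epsilon> = 0\<close> is not excluded a priori.\<close>
  have main: "?B \<le> \<delta>" if "\<delta> > 0" "\<epsilon> \<le> \<delta>" for \<delta>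
  proof -
    define p where "p = smult (1 / \<delta>) (1 - s \<circ>\<^sub>p [:real t, 1:])"
    have poly_p: "poly p y = (1 - poly s (real t + y)) / \<delta>" for y
      by (simp add: p_def poly_pcompose)
    have degp: "degree p \<le> d"
      unfolding p_def using assms(4)
      by (auto intro!: order.trans[OF degree_smult_le] degree_diff_le order.trans[OF degree_pcompose_le])
    have "\<bar>poly p (real k)\<bar> \<le> 1" if "k \<in> {0..n}" for k
    proof -
      have "t + k \<in> {t..N}"
        using that assms(3) by (auto simp: n_def)
      then have "1 - \<epsilon> \<le> poly s (real (t + k)) \<and> poly s (real (t + k)) \<le> 1"
        using assms(7) by blast
      then show ?thesis
        using \<open>\<delta> > 0\<close> \<open>\<epsilon> \<le> \<delta>\<close> by (simp add: poly_p)
    qed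
    \<comment> \<open>The inequality is instantiated at the exact degree of \<open>p\<close>, for
      which only the upper bound \<open>d\<close> has been derived; the bound grows with the degree,
      so it can be weakened to \<open>d\<close>.\<close>
    then have "\<forall>x\<in>{0..real n}. \<bar>poly p x\<bar> < a * exp (b * (real (degree p))\<^sup>2 / real n)"
      using assms(1) n(2) order.trans[OF degp assms(5)]
      unfolding coppersmith_rivlin_def n_def[symmetric] by blast
    moreover have "a * exp (b * (real (degree p))\<^sup>2 / real n) \<le> a * exp (b * (real d)\<^sup>2 / real n)"
      using ab degp by (simp add: divide_right_mono power_mono)
    ultimately have p_le: "\<bar>poly p x\<bar> \<le> a * exp (b * (real d)\<^sup>2 / real n)" if "x \<in> {0..real n}" for x
      using that by force
    \<comment> \<open>The substitution maps [-1, 1] onto [0, n] with orientation reversed, so the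
      point -t to the left of [0, n] comes from a point to the right of 1, as the growth bound
      requires.\<close>
    define r where "r = p \<circ>\<^sub>p [:real n / 2, - (real n / 2):]"
    have poly_r: "poly r y = poly p (real n / 2 * (1 - y))" for y
      by (simp add: r_def poly_pcompose field_simps)
    have degr: "degree r \<le> d"
      unfolding r_def using degp by (auto intro: order.trans[OF degree_pcompose_le])
    have r_le: "\<bar>poly r y\<bar> \<le> a * exp (b * (real d)\<^sup>2 / real n)" if "\<bar>y\<bar> \<le> 1" for y
    proof -
      have "real n / 2 * (1 - y) \<in> {0..real n}"
        using that mult_left_mono[of "1 - y" 2 "real n / 2"] by auto
      then show ?thesis
        unfolding poly_r by (rule p_le)
    qed
    define \<mu> where "\<mu> = 2 * real t / real n"
    have "real n / 2 * (1 - (1 + \<mu>)) = - real t"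
      using n(2) by (simp add: \<mu>_def)
    then have "\<bar>poly r (1 + \<mu>)\<bar> = 1 / \<delta>"
      using \<open>\<delta> > 0\<close> assms(6) by (simp add: poly_r poly_p)
    \<comment> \<open>Here \<open>N = n + t\<close> merges 4t/n + 4t^2/n^2 into one fraction. The 4
      leaves the root as 2 and doubles the constant 2 of the growth bound to the 4 of the
      claim.\<close>
    moreover have "2 * \<mu> + \<mu>\<^sup>2 = 4 * (real t * real N / (real n)\<^sup>2)"
      using n(2) by (simp add: \<mu>_def n(3) field_simps power2_eq_square)
    then have "sqrt (2 * \<mu> + \<mu>\<^sup>2) = 2 * sqrt (real t * real N / (real n)\<^sup>2)"
      by (simp only: real_sqrt_mult real_sqrt_four)
    ultimately have "1 / \<delta> \<le> a * exp (b * (real d)\<^sup>2 / real n)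
                             * exp (4 * real d * sqrt (real t * real N / (real n)\<^sup>2))"
      using poly_growth_outside_interval_exp[OF degr r_le, of \<mu>] by (simp add: \<mu>_def mult.assoc)
    then show ?thesis
      unfolding n(1) using ab \<open>\<delta> > 0\<close> by (simp add: exp_diff exp_minus field_simps)
  qed
  define B where "B = ?B"
  have "B > 0" using ab by (simp add: B_def)
  \<comment> \<open>This choice of \<open>\<delta>\<close> is positive whatever the sign of
    \<open>\<epsilon>\<close>; since \<open>B \<le> B / 2\<close> is impossible for positive
    \<open>B\<close>, the maximum must be attained by \<open>\<epsilon>\<close>.\<close>
  have "B \<le> max \<epsilon> (B / 2)"
    using main[of "max \<epsilon> (B / 2)"] \<open>B > 0\<close> unfolding B_def[symmetric] by simp
  then have "B \<le> \<epsilon>"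
    using \<open>B > 0\<close> unfolding le_max_iff_disj by linarith
  then show ?thesis
    by (simp only: B_def)
qed

end
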